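(* Let $m\in(0,\infty)$, $p>\max\{1,m\}$ and $\sigma>0$, set $$p_G:=1+\frac{\sigma(1-m)}{2},$$ and let $u_0$ be a function satisfying, for some $\gamma>0$, $$u_0\in L^{\infty}(\mathbb{R}^N),\qquad u_0\ge 0,\qquad \lim_{|x|\to\infty}|x|^{\gamma}u_0(x)=L\in(0,\infty).$$ Then, if either $$p\ge p_G\quad\text{and}\quad \gamma<\frac{\sigma}{p-1}=\frac{\sigma+2}{p-m}-\frac{2(p-p_G)}{(p-1)(p-m)},$$ or $$1<p<p_G\quad\text{and}\quad \gamma<\frac{\sigma+2}{p-m},$$ the Cauchy problem $$\partial_t u=\Delta u^m+|x|^{\sigma}u^p,\quad (t,x)\in(0,\infty)\times\mathbb{R}^N,\qquad u(0,x)=u_0(x),\quad x\in\mathbb{R}^N,$$ has no solution. Moreover, there is $L_0\in(0,\infty)$ such that this Cauchy problem has no solution if $$1<p<p_G,\qquad \gamma=\frac{\sigma+2}{p-m}\qquad\text{and}\qquad L>L_0.$$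
   Context: Here $N$ is the space dimension. Solutions are non-negative weak solutions to the Cauchy problem defined on some time interval $(0,T)$, $T\in(0,\infty)$. "No solution" means that there is no such solution, even on a short time interval (instantaneous blow-up). *)

theory Defs
  imports "HOL-Analysis.Analysis"
begin

definition p_G :: "real \<Rightarrow> real \<Rightarrow> real" where
  "p_G m \<sigma> = 1 + \<sigma> * (1 - m) / 2"

abbreviation dir_deriv :: "'a::euclidean_space \<Rightarrow> ('a \<Rightarrow> real) \<Rightarrow> 'a \<Rightarrow> real" where
  "dir_deriv v \<phi> \<equiv> (\<lambda>z. frechet_derivative \<phi> (at z) v)"

primrec C_k :: "nat \<Rightarrow> ('a::euclidean_space \<Rightarrow> real) \<Rightarrow> bool" where
  "C_k 0 \<phi> \<longleftrightarrow> continuous_on UNIV \<phi>"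
| "C_k (Suc k) \<phi> \<longleftrightarrow> (\<forall>z. \<phi> differentiable (at z)) \<and> (\<forall>v. C_k k (dir_deriv v \<phi>))"

definition smooth :: "('a::euclidean_space \<Rightarrow> real) \<Rightarrow> bool" where
  "smooth \<phi> \<longleftrightarrow> (\<forall>k. C_k k \<phi>)"

definition dt :: "(real \<times> 'a::euclidean_space \<Rightarrow> real) \<Rightarrow> real \<times> 'a \<Rightarrow> real" where
  "dt \<phi> = dir_deriv (1, 0) \<phi>"

definition laplacian :: "(real \<times> 'a::euclidean_space \<Rightarrow> real) \<Rightarrow> real \<times> 'a \<Rightarrow> real" where
  "laplacian \<phi> z = (\<Sum>e\<in>Basis. dir_deriv (0, e) (dir_deriv (0, e) \<phi>) z)"

text \<open>Elements of \<open>C\<^sub>c\<^sup>\<infinity>([0,T) \<times> \<real>\<^sup>N)\<close>, represented by smooth extensions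
  to negative times; in particular they need not vanish at \<open>t = 0\<close>.\<close>

definition test_function :: "real \<Rightarrow> (real \<times> 'a::euclidean_space \<Rightarrow> real) \<Rightarrow> bool" where
  "test_function T \<phi> \<longleftrightarrow>
     smooth \<phi> \<and> compact (closure {z. \<phi> z \<noteq> 0}) \<and> closure {z. \<phi> z \<noteq> 0} \<subseteq> {..<T} \<times> UNIV"

text \<open>Integrability is local in \<open>[0,T) \<times> \<real>\<^sup>N\<close>, i.e. up to the initial time. The values
  on the null set \<open>t = 0\<close> are irrelevant.\<close>

definition locally_integrable :: "real \<Rightarrow> (real \<times> 'a::euclidean_space \<Rightarrow> real) \<Rightarrow> bool" where
  "locally_integrable T f \<longleftrightarrow>
     (\<forall>K. compact K \<and> K \<subseteq> {0..<T} \<times> UNIV \<longrightarrow> f absolutely_integrable_on K)"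

text \<open>Non-negative weak (distributional) solutions on \<open>(0,T)\<close> of
  \<open>\<partial>\<^sub>t u = \<Delta> u\<^sup>m + |x|\<^sup>\<sigma> u\<^sup>p\<close>, \<open>u(0) = u0\<close>. The initial condition
  is carried by the last term of the weak identity.\<close>

definition weak_solution ::
  "real \<Rightarrow> real \<Rightarrow> real \<Rightarrow> ('a::euclidean_space \<Rightarrow> real) \<Rightarrow> real \<Rightarrow> (real \<times> 'a \<Rightarrow> real) \<Rightarrow> bool"
where
  "weak_solution m p \<sigma> u0 T u \<longleftrightarrow>
     (AE z in lebesgue. z \<in> {0<..<T} \<times> UNIV \<longrightarrow> 0 \<le> u z) \<and>
     locally_integrable T u \<and>
     locally_integrable T (\<lambda>z. u z powr m) \<and>
     locally_integrable T (\<lambda>z. norm (snd z) powr \<sigma> * u z powr p) \<and>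
     (\<forall>\<phi>. test_function T \<phi> \<longrightarrow>
        (LINT z:{0<..<T} \<times> UNIV|lebesgue.
           u z * dt \<phi> z + u z powr m * laplacian \<phi> z
           + norm (snd z) powr \<sigma> * u z powr p * \<phi> z)
        + (LINT x|lebesgue. u0 x * \<phi> (0, x)) = 0)"

definition no_solution :: "real \<Rightarrow> real \<Rightarrow> real \<Rightarrow> ('a::euclidean_space \<Rightarrow> real) \<Rightarrow> bool" where
  "no_solution m p \<sigma> u0 \<longleftrightarrow> (\<forall>T>0. \<nexists>u. weak_solution m p \<sigma> u0 T u)"

definition initial_datum :: "real \<Rightarrow> real \<Rightarrow> ('a::euclidean_space \<Rightarrow> real) \<Rightarrow> bool" where
  "initial_datum \<gamma> L u0 \<longleftrightarrow>
     u0 \<in> borel_measurable lebesgue \<and>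
     (\<exists>C. AE x in lebesgue. \<bar>u0 x\<bar> \<le> C) \<and>
     (AE x in lebesgue. 0 \<le> u0 x) \<and>
     ((\<lambda>x. norm x powr \<gamma> * u0 x) \<longlongrightarrow> L) at_infinity"

end

theory Submission
  imports Defs
begin

text \<open>
  Test the equation with a bump \<open>\<phi>\<close> that lives for a time \<open>\<tau> < T\<close> on a ball of radius \<open>R\<close> whose
  centre is at distance \<open>2 R\<close> from the origin, so that \<open>|x|\<close> lies between \<open>R\<close> and \<open>3 R\<close> there. The
  derivatives of the bump satisfy \<open>|\<partial>\<^sub>t \<phi>| \<le> (K / \<tau>) \<phi>\<^sup>\<theta>\<close> and \<open>|\<Delta> \<phi>| \<le> (K / R\<^sup>2) \<phi>\<^sup>\<theta>\<close> for every
  exponent \<open>0 < \<theta> < 1\<close> (\<open>bump_derivative_bounds\<close>). With \<open>\<theta> = 1 / p\<close> and \<open>\<theta> = m / p\<close> respectively,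
  Young's inequality absorbs the two differential terms into the source term, which is at least
  \<open>R\<^sup>\<sigma> u\<^sup>p \<phi>\<close> (\<open>integrand_lower_bound\<close>). What remains bounds the integral of \<open>u\<^sub>0 \<phi>(0, \<cdot>)\<close>, which
  is at least of order \<open>L * R ^ N * R powr - \<gamma>\<close>. After division by \<open>R\<^sup>N\<close> this reads
  (\<open>weak_solution_tail_estimate\<close>), up to constants that depend only on \<open>m\<close>, \<open>p\<close>, \<open>\<sigma>\<close>, \<open>N\<close> and,
  through the factor \<open>3 powr - \<gamma>\<close>, on \<open>\<gamma>\<close>,
  \<open>L * R powr - \<gamma> \<le> (\<tau> * R powr \<sigma>) powr (- 1 / (p - 1)) + \<tau> * R powr - ((2 * p + \<sigma> * m) / (p - m))\<close>
  for all large \<open>R\<close> and all \<open>\<tau> < T\<close>.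

  If \<open>p \<ge> p_G\<close>, fix \<open>\<tau> = T / 2\<close>: both terms decay at least as fast as \<open>R powr - (\<sigma> / (p - 1))\<close>, which
  contradicts \<open>\<gamma> < \<sigma> / (p - 1)\<close> as \<open>R\<close> tends to infinity. If \<open>p < p_G\<close>, the choice
  \<open>\<tau> = R powr - (2 * (p_G - p) / (p - m))\<close>, which tends to zero, makes both terms equal to
  \<open>R powr - ((\<sigma> + 2) / (p - m))\<close>. This contradicts \<open>\<gamma> < (\<sigma> + 2) / (p - m)\<close>, and when equality holds
  it bounds \<open>L\<close> by a constant independent of the solution and of \<open>T\<close>.
\<close>

section \<open>A flat function and its derivatives\<close>

text \<open>The function \<open>exp (-1/s)\<close>, extended by zero to \<open>s \<le> 0\<close>, divided by \<open>s\<^sup>j\<close>. The linear span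
  of these functions is closed under differentiation, and each of them is controlled by every
  power of \<open>flat 0\<close> with positive exponent less than one.\<close>

definition flat :: "nat \<Rightarrow> real \<Rightarrow> real" where
  "flat j s = (if s \<le> 0 then 0 else exp (- 1 / s) / s ^ j)"

lemma flat_nonneg: "0 \<le> flat j s"
  by (simp add: flat_def)

lemma flat_nonpos_eq_0: "s \<le> 0 \<Longrightarrow> flat j s = 0"
  by (simp add: flat_def)

lemma flat_0_mono: "s \<le> t \<Longrightarrow> flat 0 s \<le> flat 0 t"
  by (simp add: flat_def divide_simps)

lemma power_le_fact_mult_exp:
  fixes y :: real
  assumes "0 \<le> y"
  shows "y ^ n \<le> fact n * exp y"
proof -
  have "(\<Sum>i\<in>{n}. inverse (fact i) * y ^ i) \<le> (\<Sum>i. inverse (fact i) * y ^ i)"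
    by (rule sum_le_suminf) (use assms summable_exp in auto)
  then have "inverse (fact n) * y ^ n \<le> exp y"
    by (simp add: exp_def)
  then show ?thesis
    by (simp add: field_simps)
qed

lemma flat_le_powr:
  assumes "0 < \<theta>" and "\<theta> < 1"
  shows "flat j s \<le> fact j / (1 - \<theta>) ^ j * flat 0 s powr \<theta>"
proof (cases "0 < s")
  case True
  have "((1 - \<theta>) / s) ^ j \<le> fact j * exp ((1 - \<theta>) / s)"
    by (rule power_le_fact_mult_exp) (use assms True in simp)
  then have "1 / s ^ j \<le> fact j / (1 - \<theta>) ^ j * exp ((1 - \<theta>) / s)"
    using assms True by (simp add: field_simps power_divide)
  then have "exp (- 1 / s) * (1 / s ^ j)
      \<le> exp (- 1 / s) * (fact j / (1 - \<theta>) ^ j * exp ((1 - \<theta>) / s))"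
    by (rule mult_left_mono) simp
  also have "\<dots> = fact j / (1 - \<theta>) ^ j * (exp (- 1 / s) * exp ((1 - \<theta>) / s))"
    by (simp only: mult_ac)
  also have "exp (- 1 / s) * exp ((1 - \<theta>) / s) = exp (\<theta> * (- 1 / s))"
    using True by (simp add: exp_add [symmetric] field_simps)
  finally show ?thesis
    using True by (simp add: flat_def exp_powr_real mult.commute)
qed (simp add: flat_def)

lemma flat_le_fact: "flat j s \<le> fact j"
proof (cases "0 < s")
  case True
  have "(1 / s) ^ j \<le> fact j * exp (1 / s)"
    by (rule power_le_fact_mult_exp) (use True in simp)
  then have "exp (- 1 / s) * (1 / s) ^ j \<le> exp (- 1 / s) * (fact j * exp (1 / s))"
    by (rule mult_left_mono) simp
  also have "\<dots> = fact j * (exp (- (1 / s)) * exp (1 / s))"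
    by simp
  also have "\<dots> = fact j"
    by (simp add: exp_add [symmetric])
  finally show ?thesis
    using True by (simp add: flat_def power_divide)
qed (simp add: flat_def)

lemma DERIV_flat: "(flat j has_real_derivative - real j * flat (j + 1) s + flat (j + 2) s) (at s)"
proof (cases s "0 :: real" rule: linorder_cases)
  case less
  have "(flat j has_real_derivative 0) (at s)"
    by (rule has_field_derivative_transform_within [where f = "\<lambda>_. 0" and d = "- s"])
       (use less in \<open>auto simp: flat_def dist_real_def\<close>)
  then show ?thesis
    using less by (simp add: flat_def)
next
  case equal
  \<comment> \<open>At the origin, \<open>flat j h = h\<^sup>2 flat (j + 2) h\<close> is of second order.\<close>
  have bound: "\<bar>flat j h / h\<bar> \<le> fact (j + 2) * \<bar>h\<bar>" for h
  proof (cases "0 < h")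
    case True
    have "flat j h / h = flat (j + 2) h * h"
      using True by (simp add: flat_def power_add field_simps power2_eq_square)
    moreover have "flat (j + 2) h * h \<le> fact (j + 2) * h"
      by (rule mult_right_mono [OF flat_le_fact]) (use True in simp)
    ultimately show ?thesis
      using True flat_nonneg [of "j + 2" h] by simp
  next
    case False
    then show ?thesis
      by (simp add: flat_nonpos_eq_0 mult_nonneg_nonpos del: fact_Suc)
  qed
  have "((\<lambda>h. flat j h / h) \<longlongrightarrow> 0) (at 0)"
    by (rule Lim_null_comparison [where g = "\<lambda>h. fact (j + 2) * \<bar>h\<bar>"])
       (use bound in \<open>auto intro!: tendsto_eq_intros\<close>)
  then show ?thesis
    using equal by (simp add: DERIV_def flat_def)
next
  case greater
  have "((\<lambda>s. exp (- 1 / s)) has_real_derivative exp (- 1 / s) * (1 / s\<^sup>2)) (at s)"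
    using greater by (auto intro!: derivative_eq_intros simp: power2_eq_square)
  from DERIV_divide [OF this DERIV_pow [of j]]
  have "((\<lambda>s. exp (- 1 / s) / s ^ j) has_real_derivative
      (exp (- 1 / s) * (1 / s\<^sup>2) * s ^ j - exp (- 1 / s) * (real j * s ^ (j - Suc 0))) / (s ^ j * s ^ j)) (at s)"
    using greater by simp
  also have "(exp (- 1 / s) * (1 / s\<^sup>2) * s ^ j - exp (- 1 / s) * (real j * s ^ (j - Suc 0))) / (s ^ j * s ^ j)
      = - real j * flat (j + 1) s + flat (j + 2) s"
    using greater by (cases j) (simp_all add: flat_def field_simps power2_eq_square)
  finally have "((\<lambda>s. exp (- 1 / s) / s ^ j) has_real_derivative
      - real j * flat (j + 1) s + flat (j + 2) s) (at s)" .
  then show ?thesis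
    by (rule has_field_derivative_transform_within [where d = s])
       (use greater in \<open>auto simp: flat_def dist_real_def\<close>)
qed

section \<open>Smooth functions\<close>

lemma dir_deriv_eq:
  assumes "(f has_derivative f') (at z)"
  shows "dir_deriv v f z = f' v"
  using frechet_derivative_at [OF assms] by simp

text \<open>The next two lemmas replace the Frechet derivatives in the definition of \<open>C_k\<close> by
  \<open>has_derivative\<close>, for which there are calculation rules.\<close>

lemma C_k_SucI:
  assumes "\<And>z. (f has_derivative f' z) (at z)" and "\<And>v. C_k k (\<lambda>z. f' z v)"
  shows "C_k (Suc k) f"
proof -
  have "dir_deriv v f = (\<lambda>z. f' z v)" for v
    using assms(1) by (simp add: dir_deriv_eq fun_eq_iff)
  then show ?thesis
    using assms by (auto simp: differentiable_def)
qed

lemma C_k_Suc_has_derivative: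
  assumes "C_k (Suc k) f"
  shows "(f has_derivative (\<lambda>v. dir_deriv v f z)) (at z)"
  using assms frechet_derivative_works by auto

lemma C_k_Suc_imp_C_k: "C_k (Suc k) f \<Longrightarrow> C_k k f"
proof (induction k arbitrary: f)
  case 0
  then show ?case
    by (auto intro!: differentiable_imp_continuous_within continuous_at_imp_continuous_on)
next
  case (Suc k)
  then show ?case
    unfolding C_k.simps(2) [of "Suc k"] C_k.simps(2) [of k f] by blast
qed

lemma C_k_const: "C_k k (\<lambda>_. c)"
proof (induction k arbitrary: c)
  case (Suc k)
  show ?case
    by (rule C_k_SucI [where f' = "\<lambda>_ _. 0"]) (auto intro: Suc)
qed simp

lemma C_k_add: "C_k k f \<Longrightarrow> C_k k g \<Longrightarrow> C_k k (\<lambda>z. f z + g z)"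
proof (induction k arbitrary: f g)
  case 0
  then show ?case by (simp add: continuous_on_add)
next
  case (Suc k)
  show ?case
  proof (rule C_k_SucI)
    show "((\<lambda>z. f z + g z) has_derivative (\<lambda>v. dir_deriv v f z + dir_deriv v g z)) (at z)" for z
      by (intro has_derivative_add C_k_Suc_has_derivative [OF Suc.prems(1)]
        C_k_Suc_has_derivative [OF Suc.prems(2)])
    show "C_k k (\<lambda>z. dir_deriv v f z + dir_deriv v g z)" for v
      using Suc.prems by (intro Suc.IH) auto
  qed
qed

lemma C_k_mult: "C_k k f \<Longrightarrow> C_k k g \<Longrightarrow> C_k k (\<lambda>z. f z * g z)"
proof (induction k arbitrary: f g)
  case 0
  then show ?case by (simp add: continuous_on_mult)
next
  case (Suc k)
  show ?case
  proof (rule C_k_SucI)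
    show "((\<lambda>z. f z * g z) has_derivative (\<lambda>v. f z * dir_deriv v g z + dir_deriv v f z * g z)) (at z)"
      for z
      by (intro has_derivative_mult C_k_Suc_has_derivative [OF Suc.prems(1)]
        C_k_Suc_has_derivative [OF Suc.prems(2)])
    show "C_k k (\<lambda>z. f z * dir_deriv v g z + dir_deriv v f z * g z)" for v
      using Suc.prems by (intro C_k_add Suc.IH C_k_Suc_imp_C_k [OF Suc.prems(1)]
        C_k_Suc_imp_C_k [OF Suc.prems(2)]) auto
  qed
qed

lemma C_k_bounded_linear:
  assumes "bounded_linear f"
  shows "C_k k f"
proof (cases k)
  case 0
  then show ?thesis
    using assms by (simp add: linear_continuous_on)
next
  case (Suc n)
  show ?thesis
    unfolding Suc
    by (rule C_k_SucI [where f' = "\<lambda>_. f"])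
       (auto intro: C_k_const bounded_linear_imp_has_derivative assms)
qed

lemma has_derivative_flat_comp:
  assumes "(w has_derivative w') (at z)"
  shows "((\<lambda>z. flat j (w z)) has_derivative
    (\<lambda>v. (- real j * flat (j + 1) (w z) + flat (j + 2) (w z)) * w' v)) (at z)"
  using DERIV_compose_FDERIV [OF DERIV_flat assms, of j] by (simp add: mult.commute)

lemma has_derivative_flat_0_comp:
  assumes "(w has_derivative w') (at z)"
  shows "((\<lambda>z. flat 0 (w z)) has_derivative (\<lambda>v. flat 2 (w z) * w' v)) (at z)"
  using has_derivative_flat_comp [OF assms, of 0] by (simp add: eval_nat_numeral)

lemma has_derivative_flat_2_comp:
  assumes "(w has_derivative w') (at z)"
  shows "((\<lambda>z. flat 2 (w z)) has_derivative (\<lambda>v. (flat 4 (w z) - 2 * flat 3 (w z)) * w' v)) (at z)"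
  using has_derivative_flat_comp [OF assms, of 2] by (simp add: eval_nat_numeral)

lemma C_k_flat_comp: "C_k k w \<Longrightarrow> C_k k (\<lambda>z. flat j (w z))"
proof (induction k arbitrary: j)
  case 0
  have "continuous_on UNIV (flat j)"
    using DERIV_flat DERIV_isCont by (blast intro: continuous_at_imp_continuous_on)
  then show ?case
    using 0 continuous_on_compose2 [of UNIV "flat j" UNIV w] by simp
next
  case (Suc k)
  show ?case
  proof (rule C_k_SucI)
    show "((\<lambda>z. flat j (w z)) has_derivative
      (\<lambda>v. (- real j * flat (j + 1) (w z) + flat (j + 2) (w z)) * dir_deriv v w z)) (at z)" for z
      by (intro has_derivative_flat_comp C_k_Suc_has_derivative [OF Suc.prems])
    show "C_k k (\<lambda>z. (- real j * flat (j + 1) (w z) + flat (j + 2) (w z)) * dir_deriv v w z)" for v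
      using Suc.prems
      by (intro C_k_mult C_k_add C_k_const Suc.IH C_k_Suc_imp_C_k [OF Suc.prems]) auto
  qed
qed

section \<open>A test function concentrated away from the origin\<close>

text \<open>For \<open>\<tau>, R > 0\<close> this function is positive exactly inside the ellipsoid around \<open>(0, a)\<close> with
  semi-axes \<open>\<tau>\<close> in time and \<open>R\<close> in space, so that \<open>\<lambda>z. flat 0 (ellipsoid \<tau> R a z)\<close> is a smooth
  bump supported there.\<close>

definition ellipsoid :: "real \<Rightarrow> real \<Rightarrow> 'a::euclidean_space \<Rightarrow> real \<times> 'a \<Rightarrow> real" where
  "ellipsoid \<tau> R a z = 1 - (fst z)\<^sup>2 / \<tau>\<^sup>2 - (norm (snd z - a))\<^sup>2 / R\<^sup>2"

lemma has_derivative_ellipsoid: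
  "(ellipsoid \<tau> R a has_derivative
    (\<lambda>v. - 2 / \<tau>\<^sup>2 * fst z * fst v + - 2 / R\<^sup>2 * ((snd z - a) \<bullet> snd v))) (at z)"
proof -
  have eq: "ellipsoid \<tau> R a = (\<lambda>z. 1 - 1 / \<tau>\<^sup>2 * (fst z * fst z) - 1 / R\<^sup>2 * ((snd z - a) \<bullet> (snd z - a)))"
    unfolding ellipsoid_def power2_norm_eq_inner by (simp add: fun_eq_iff power2_eq_square)
  show ?thesis
    unfolding eq
    by (rule derivative_eq_intros refl)+ (simp add: fun_eq_iff inner_commute)
qed

lemma C_k_ellipsoid: "C_k k (ellipsoid \<tau> R a)"
proof -
  have "C_k (Suc k) (ellipsoid \<tau> R a)"
  proof (rule C_k_SucI [OF has_derivative_ellipsoid])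
    fix v :: "real \<times> 'a"
    have "C_k k (\<lambda>z :: real \<times> 'a. - 2 / \<tau>\<^sup>2 * fst z * fst v + - 2 / R\<^sup>2 * (snd z \<bullet> snd v)
      + 2 / R\<^sup>2 * (a \<bullet> snd v))"
      by (intro C_k_add C_k_mult C_k_const C_k_bounded_linear bounded_linear_fst
        bounded_linear_compose [OF bounded_linear_inner_left bounded_linear_snd])
    then show "C_k k (\<lambda>z. - 2 / \<tau>\<^sup>2 * fst z * fst v + - 2 / R\<^sup>2 * ((snd z - a) \<bullet> snd v))"
      by (simp add: inner_diff_left algebra_simps)
  qed
  then show ?thesis
    by (rule C_k_Suc_imp_C_k)
qed

lemma ellipsoid_pos_imp:
  assumes "0 < ellipsoid \<tau> R a z" and "0 < \<tau>" and "0 < R"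
  shows "\<bar>fst z\<bar> \<le> \<tau>" and "norm (snd z - a) \<le> R"
proof -
  have *: "(fst z)\<^sup>2 / \<tau>\<^sup>2 + (norm (snd z - a))\<^sup>2 / R\<^sup>2 \<le> 1"
    using assms by (simp add: ellipsoid_def)
  moreover have "0 \<le> (fst z)\<^sup>2 / \<tau>\<^sup>2" "0 \<le> (norm (snd z - a))\<^sup>2 / R\<^sup>2"
    by simp_all
  ultimately have "(fst z)\<^sup>2 / \<tau>\<^sup>2 \<le> 1" "(norm (snd z - a))\<^sup>2 / R\<^sup>2 \<le> 1"
    by linarith+
  then have "(fst z)\<^sup>2 \<le> \<tau>\<^sup>2" "(norm (snd z - a))\<^sup>2 \<le> R\<^sup>2"
    using assms by (simp_all add: field_simps)
  then show "\<bar>fst z\<bar> \<le> \<tau>" "norm (snd z - a) \<le> R"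
    using assms by (simp_all add: abs_le_square_iff power2_le_iff_abs_le)
qed

lemma test_function_bump:
  fixes a :: "'a::euclidean_space"
  assumes "0 < \<tau>" and "\<tau> < T" and "0 < R"
  shows "test_function T (\<lambda>z. flat 0 (ellipsoid \<tau> R a z))"
proof -
  let ?K = "{- \<tau>..\<tau>} \<times> cball a R"
  have "{z. flat 0 (ellipsoid \<tau> R a z) \<noteq> 0} \<subseteq> ?K"
  proof
    fix z
    assume "z \<in> {z. flat 0 (ellipsoid \<tau> R a z) \<noteq> 0}"
    then have "0 < ellipsoid \<tau> R a z"
      using flat_nonpos_eq_0 [of "ellipsoid \<tau> R a z"] by fastforce
    from ellipsoid_pos_imp [OF this] show "z \<in> ?K"
      using assms by (simp add: mem_Times_iff dist_norm norm_minus_commute abs_le_iff)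
  qed
  moreover have K: "compact ?K"
    by (intro compact_Times) auto
  ultimately have sub: "closure {z. flat 0 (ellipsoid \<tau> R a z) \<noteq> 0} \<subseteq> ?K"
    by (intro closure_minimal compact_imp_closed)
  then have "compact (closure {z. flat 0 (ellipsoid \<tau> R a z) \<noteq> 0})"
    using compact_Int_closed [OF K closed_closure] by (metis inf.absorb2)
  moreover have "?K \<subseteq> {..<T} \<times> UNIV"
    using assms by auto
  ultimately show ?thesis
    using sub by (auto simp: test_function_def smooth_def intro: C_k_flat_comp C_k_ellipsoid)
qed

lemma dt_bump:
  "dt (\<lambda>z. flat 0 (ellipsoid \<tau> R a z)) z = - 2 / \<tau>\<^sup>2 * fst z * flat 2 (ellipsoid \<tau> R a z)"
  unfolding dt_def
  by (subst dir_deriv_eq [OF has_derivative_flat_0_comp [OF has_derivative_ellipsoid]]) simp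

lemma laplacian_bump:
  fixes a :: "'a::euclidean_space"
  shows "laplacian (\<lambda>z. flat 0 (ellipsoid \<tau> R a z)) z =
    4 * (norm (snd z - a))\<^sup>2 / R ^ 4 * (flat 4 (ellipsoid \<tau> R a z) - 2 * flat 3 (ellipsoid \<tau> R a z))
    - 2 * DIM('a) / R\<^sup>2 * flat 2 (ellipsoid \<tau> R a z)"
proof -
  let ?w = "ellipsoid \<tau> R a"
  have first: "dir_deriv (0, e) (\<lambda>z. flat 0 (?w z)) = (\<lambda>z. flat 2 (?w z) * (- 2 / R\<^sup>2 * ((snd z - a) \<bullet> e)))"
    for e
    by (rule ext, subst dir_deriv_eq [OF has_derivative_flat_0_comp [OF has_derivative_ellipsoid]]) simp
  have second: "dir_deriv (0, e) (dir_deriv (0, e) (\<lambda>z. flat 0 (?w z))) z =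
      4 / R ^ 4 * (flat 4 (?w z) - 2 * flat 3 (?w z)) * ((snd z - a) \<bullet> e)\<^sup>2 - 2 / R\<^sup>2 * flat 2 (?w z)"
    if e: "e \<in> Basis" for e
  proof -
    have linear: "((\<lambda>z. - 2 / R\<^sup>2 * ((snd z - a) \<bullet> e)) has_derivative (\<lambda>v. - 2 / R\<^sup>2 * (snd v \<bullet> e))) (at z)"
      by (rule derivative_eq_intros refl)+ simp
    have "dir_deriv (0, e) (\<lambda>z. flat 2 (?w z) * (- 2 / R\<^sup>2 * ((snd z - a) \<bullet> e))) z =
        flat 2 (?w z) * (- 2 / R\<^sup>2 * (e \<bullet> e))
        + (flat 4 (?w z) - 2 * flat 3 (?w z)) * (- 2 / R\<^sup>2 * ((snd z - a) \<bullet> e))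
          * (- 2 / R\<^sup>2 * ((snd z - a) \<bullet> e))"
      by (subst dir_deriv_eq [OF has_derivative_mult [OF
        has_derivative_flat_2_comp [OF has_derivative_ellipsoid] linear]]) simp
    also have "\<dots> = 4 / R ^ 4 * (flat 4 (?w z) - 2 * flat 3 (?w z)) * ((snd z - a) \<bullet> e)\<^sup>2
        - 2 / R\<^sup>2 * flat 2 (?w z)"
      using e by (simp add: power4_eq_xxxx power2_eq_square left_diff_distrib right_diff_distrib
        diff_divide_distrib mult_ac del: inner_simps)
    finally show ?thesis
      unfolding first .
  qed
  have "laplacian (\<lambda>z. flat 0 (?w z)) z =
      4 / R ^ 4 * (flat 4 (?w z) - 2 * flat 3 (?w z)) * (\<Sum>e\<in>Basis. ((snd z - a) \<bullet> e)\<^sup>2)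
      - 2 * DIM('a) / R\<^sup>2 * flat 2 (?w z)"
    unfolding laplacian_def by (simp add: second sum_subtractf sum_distrib_left)
  also have "(\<Sum>e\<in>Basis. ((snd z - a) \<bullet> e)\<^sup>2) = (norm (snd z - a))\<^sup>2"
    unfolding power2_norm_eq_inner euclidean_inner [of "snd z - a" "snd z - a"]
    by (simp only: power2_eq_square)
  finally show ?thesis
    by (simp add: algebra_simps)
qed

section \<open>The test function estimate\<close>

text \<open>Young's inequality in a form with explicit constant: the second summand is the value of the
  left-hand side at the point where \<open>a powr (q - r)\<close> reaches \<open>2 * K / A\<close>, beyond which the first one
  dominates.\<close>

lemma young_absorption:
  fixes a A K q r :: real
  assumes "0 \<le> a" and "0 < A" and "0 < K" and "0 < r" and "r < q"
  shows "K * a powr r \<le> A / 2 * a powr q + K * (2 * K / A) powr (r / (q - r))"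
proof (cases "K \<le> A / 2 * a powr (q - r)")
  case True
  have "K * a powr r \<le> A / 2 * a powr (q - r) * a powr r"
    by (rule mult_right_mono [OF True]) simp
  also have "\<dots> = A / 2 * a powr q"
    by (simp add: powr_add [symmetric])
  finally show ?thesis
    using assms by (simp add: add_increasing2)
next
  case False
  then have "a powr (q - r) \<le> 2 * K / A"
    using assms by (simp add: field_simps)
  then have "(a powr (q - r)) powr (r / (q - r)) \<le> (2 * K / A) powr (r / (q - r))"
    using assms by (intro powr_mono2) auto
  then have "a powr r \<le> (2 * K / A) powr (r / (q - r))"
    using assms by (simp add: powr_powr)
  then have "K * a powr r \<le> K * (2 * K / A) powr (r / (q - r))"
    using assms by (intro mult_left_mono) auto
  then show ?thesis
    using assms by (simp add: add_increasing)
qed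

text \<open>Here \<open>v\<close>, \<open>b\<close>, \<open>D\<^sub>1\<close>, \<open>D\<^sub>2\<close> and \<open>X\<close> stand for the values at one point of the solution, the test
  function, its time derivative, its Laplacian and the weight \<open>|x|\<^sup>\<sigma>\<close>.\<close>

lemma integrand_lower_bound:
  fixes v X A K\<^sub>1 K\<^sub>2 b D\<^sub>1 D\<^sub>2 m p :: real
  assumes "0 < m" "m < p" "1 < p" "0 \<le> v" "0 \<le> b" "0 < A" "A \<le> X" "0 < K\<^sub>1" "0 < K\<^sub>2"
    and D\<^sub>1: "\<bar>D\<^sub>1\<bar> \<le> K\<^sub>1 * b powr (1 / p)" and D\<^sub>2: "\<bar>D\<^sub>2\<bar> \<le> K\<^sub>2 * b powr (m / p)"
  shows "- (K\<^sub>1 * (2 * K\<^sub>1 / A) powr (1 / (p - 1)) + K\<^sub>2 * (2 * K\<^sub>2 / A) powr (m / (p - m)))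
    \<le> v * D\<^sub>1 + v powr m * D\<^sub>2 + X * v powr p * b"
proof -
  \<comment> \<open>In terms of \<open>a\<close>, the three terms are of order \<open>a\<close>, \<open>a powr m\<close> and \<open>a powr p\<close>.\<close>
  define a where "a = v * b powr (1 / p)"
  have a: "0 \<le> a" "a powr 1 = v * b powr (1 / p)" "a powr m = v powr m * b powr (m / p)"
    "a powr p = v powr p * b"
    using assms by (simp_all add: a_def powr_mult powr_powr)
  have "- (v * D\<^sub>1) \<le> v * (K\<^sub>1 * b powr (1 / p))"
    using mult_left_mono [of "- D\<^sub>1" "K\<^sub>1 * b powr (1 / p)" v] D\<^sub>1 assms by (simp add: abs_le_iff)
  then have 1: "- (v * D\<^sub>1) \<le> A / 2 * a powr p + K\<^sub>1 * (2 * K\<^sub>1 / A) powr (1 / (p - 1))"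
    using young_absorption [of a A K\<^sub>1 1 p] assms a by (simp add: mult_ac)
  have "- (v powr m * D\<^sub>2) \<le> v powr m * (K\<^sub>2 * b powr (m / p))"
    using mult_left_mono [of "- D\<^sub>2" "K\<^sub>2 * b powr (m / p)" "v powr m"] D\<^sub>2 by (simp add: abs_le_iff)
  then have 2: "- (v powr m * D\<^sub>2) \<le> A / 2 * a powr p + K\<^sub>2 * (2 * K\<^sub>2 / A) powr (m / (p - m))"
    using young_absorption [of a A K\<^sub>2 m p] assms a by (simp add: mult_ac)
  have "A * a powr p \<le> X * a powr p"
    using assms by (intro mult_right_mono) auto
  then have "A * a powr p \<le> X * v powr p * b"
    by (simp add: a mult.assoc)
  with 1 2 show ?thesis
    by argo
qed

lemma bump_derivative_bounds:
  assumes "0 < \<theta>" and "\<theta> < 1"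
  shows "\<exists>K>0. \<forall>\<tau>>0. \<forall>R>0. \<forall>(a :: 'a::euclidean_space) z.
    \<bar>dt (\<lambda>z. flat 0 (ellipsoid \<tau> R a z)) z\<bar> \<le> K / \<tau> * flat 0 (ellipsoid \<tau> R a z) powr \<theta> \<and>
    \<bar>laplacian (\<lambda>z. flat 0 (ellipsoid \<tau> R a z)) z\<bar> \<le> K / R\<^sup>2 * flat 0 (ellipsoid \<tau> R a z) powr \<theta>"
proof -
  define C where "C j = fact j / (1 - \<theta>) ^ j" for j
  define K where "K = 2 * C 2 + (4 * (C 4 + 2 * C 3) + 2 * DIM('a) * C 2)"
  have C_pos: "0 < C j" for j
    using assms by (simp add: C_def)
  have flat_le: "flat j s \<le> C j * flat 0 s powr \<theta>" for j s
    unfolding C_def by (rule flat_le_powr [OF assms])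
  have K1: "2 * C 2 \<le> K" and K2: "4 * (C 4 + 2 * C 3) + 2 * DIM('a) * C 2 \<le> K" and "0 < K"
    using C_pos [of 2] C_pos [of 3] C_pos [of 4] by (auto simp: K_def add_pos_pos add_nonneg_nonneg)
  moreover have "\<bar>dt (\<lambda>z. flat 0 (ellipsoid \<tau> R a z)) z\<bar>
        \<le> K / \<tau> * flat 0 (ellipsoid \<tau> R a z) powr \<theta> \<and>
      \<bar>laplacian (\<lambda>z. flat 0 (ellipsoid \<tau> R a z)) z\<bar>
        \<le> K / R\<^sup>2 * flat 0 (ellipsoid \<tau> R a z) powr \<theta>"
    if "0 < \<tau>" "0 < R" for \<tau> R and a :: 'a and z
  proof (cases "0 < ellipsoid \<tau> R a z")
    case False
    then show ?thesis
      by (simp add: dt_bump laplacian_bump flat_nonpos_eq_0)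
  next
    case True
    note z = ellipsoid_pos_imp [OF True that]
    define w where "w = ellipsoid \<tau> R a z"
    define g where "g = flat 0 w powr \<theta>"
    have "0 \<le> g"
      by (simp add: g_def)
    have "\<bar>dt (\<lambda>z. flat 0 (ellipsoid \<tau> R a z)) z\<bar> = 2 / \<tau>\<^sup>2 * \<bar>fst z\<bar> * flat 2 w"
      using flat_nonneg [of 2 w] by (simp add: dt_bump abs_mult w_def)
    also have "\<dots> \<le> 2 / \<tau>\<^sup>2 * \<tau> * (C 2 * g)"
      using z that flat_le [of 2 w] flat_nonneg [of 2 w] unfolding g_def
      by (intro mult_mono mult_left_mono) auto
    also have "\<dots> = (2 * C 2) / \<tau> * g"
      using that by (simp add: power2_eq_square)
    also have "\<dots> \<le> K / \<tau> * g"
      using K1 that \<open>0 \<le> g\<close> by (intro mult_right_mono divide_right_mono) auto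
    finally have dt: "\<bar>dt (\<lambda>z. flat 0 (ellipsoid \<tau> R a z)) z\<bar> \<le> K / \<tau> * g" .
    have "4 * (norm (snd z - a))\<^sup>2 / R ^ 4 \<le> 4 * R\<^sup>2 / R ^ 4"
      using z that by (intro divide_right_mono mult_left_mono power_mono) auto
    then have coeff: "4 * (norm (snd z - a))\<^sup>2 / R ^ 4 \<le> 4 / R\<^sup>2"
      using that by (simp add: power4_eq_xxxx power2_eq_square)
    have "\<bar>flat 4 w - 2 * flat 3 w\<bar> \<le> flat 4 w + 2 * flat 3 w"
      using flat_nonneg [of 4 w] flat_nonneg [of 3 w] by linarith
    also have "\<dots> \<le> (C 4 + 2 * C 3) * g"
      using flat_le [of 4 w] flat_le [of 3 w] by (simp add: g_def distrib_right)
    finally have flats: "\<bar>flat 4 w - 2 * flat 3 w\<bar> \<le> (C 4 + 2 * C 3) * g" .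
    have "\<bar>laplacian (\<lambda>z. flat 0 (ellipsoid \<tau> R a z)) z\<bar>
        \<le> \<bar>4 * (norm (snd z - a))\<^sup>2 / R ^ 4 * (flat 4 w - 2 * flat 3 w)\<bar> + \<bar>2 * DIM('a) / R\<^sup>2 * flat 2 w\<bar>"
      unfolding laplacian_bump w_def by (rule abs_triangle_ineq4)
    also have "\<dots> = 4 * (norm (snd z - a))\<^sup>2 / R ^ 4 * \<bar>flat 4 w - 2 * flat 3 w\<bar>
        + 2 * DIM('a) / R\<^sup>2 * flat 2 w"
      using flat_nonneg [of 2 w] by (simp add: abs_mult)
    also have "\<dots> \<le> 4 / R\<^sup>2 * ((C 4 + 2 * C 3) * g) + 2 * DIM('a) / R\<^sup>2 * (C 2 * g)"
      using coeff flats flat_le [of 2 w] by (intro add_mono mult_mono mult_left_mono) (auto simp: g_def)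
    also have "\<dots> = (4 * (C 4 + 2 * C 3) + 2 * DIM('a) * C 2) / R\<^sup>2 * g"
      by (simp add: add_divide_distrib distrib_right)
    also have "\<dots> \<le> K / R\<^sup>2 * g"
      using K2 \<open>0 \<le> g\<close> by (intro mult_right_mono divide_right_mono) auto
    finally show ?thesis
      using dt by (simp add: g_def w_def)
  qed
  ultimately show ?thesis
    by blast
qed

lemma content_spacetime_box:
  fixes a :: "'a::euclidean_space"
  assumes "0 \<le> \<tau>" and "0 \<le> R"
  shows "measure lborel (cbox (0, a - R *\<^sub>R One) (\<tau>, a + R *\<^sub>R One)) = \<tau> * (2 * R) ^ DIM('a)"
proof -
  have "measure lborel (cbox (a - R *\<^sub>R One) (a + R *\<^sub>R One)) = (\<Prod>i\<in>(Basis :: 'a set). 2 * R)"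
    using assms by (subst content_cbox) (auto simp: inner_simps intro!: prod.cong)
  then show ?thesis
    using assms by (simp add: content_Pair)
qed

text \<open>Testing the equation with the bump, the source term absorbs the two differential terms up
  to a constant times the volume of the support.\<close>

lemma weak_solution_initial_integral_le:
  fixes a :: "'a::euclidean_space"
  assumes u: "weak_solution m p \<sigma> u0 T u"
    and "0 < m" "m < p" "1 < p" "0 < \<sigma>" "0 < \<tau>" "\<tau> < T" "0 < R" and a: "norm a = 2 * R"
    and "0 < K\<^sub>1" "0 < K\<^sub>2"
    and K\<^sub>1: "\<And>z. \<bar>dt (\<lambda>z. flat 0 (ellipsoid \<tau> R a z)) z\<bar>
      \<le> K\<^sub>1 * flat 0 (ellipsoid \<tau> R a z) powr (1 / p)"
    and K\<^sub>2: "\<And>z. \<bar>laplacian (\<lambda>z. flat 0 (ellipsoid \<tau> R a z)) z\<bar>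
      \<le> K\<^sub>2 * flat 0 (ellipsoid \<tau> R a z) powr (m / p)"
  shows "(LINT x|lebesgue. u0 x * flat 0 (ellipsoid \<tau> R a (0, x))) \<le> \<tau> * (2 * R) ^ DIM('a) *
    (K\<^sub>1 * (2 * K\<^sub>1 / R powr \<sigma>) powr (1 / (p - 1)) + K\<^sub>2 * (2 * K\<^sub>2 / R powr \<sigma>) powr (m / (p - m)))"
proof -
  define \<phi> where "\<phi> = (\<lambda>z. flat 0 (ellipsoid \<tau> R a z))"
  define E where "E = K\<^sub>1 * (2 * K\<^sub>1 / R powr \<sigma>) powr (1 / (p - 1))
    + K\<^sub>2 * (2 * K\<^sub>2 / R powr \<sigma>) powr (m / (p - m))"
  define G where "G z = u z * dt \<phi> z + u z powr m * laplacian \<phi> z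
    + norm (snd z) powr \<sigma> * u z powr p * \<phi> z" for z
  define Q where "Q = cbox (0, a - R *\<^sub>R One) (\<tau>, a + R *\<^sub>R One)"
  let ?I = "indicator ({0<..<T} \<times> UNIV) :: real \<times> 'a \<Rightarrow> real"
  have "0 \<le> E"
    using assms by (simp add: E_def)
  have "test_function T \<phi>"
    unfolding \<phi>_def by (rule test_function_bump) (use assms in auto)
  then have identity: "(LINT z:{0<..<T} \<times> UNIV|lebesgue. G z) + (LINT x|lebesgue. u0 x * \<phi> (0, x)) = 0"
    using u unfolding weak_solution_def G_def by blast
  have bound: "- (?I z * G z) \<le> E * indicator Q z" if nonneg: "z \<in> {0<..<T} \<times> UNIV \<longrightarrow> 0 \<le> u z" for z
  proof (cases "z \<in> {0<..<T} \<times> UNIV \<and> 0 < ellipsoid \<tau> R a z")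
    case False
    then have "?I z * G z = 0"
      using K\<^sub>1 [of z] K\<^sub>2 [of z] by (auto simp: G_def \<phi>_def flat_nonpos_eq_0 indicator_def)
    show ?thesis
      unfolding \<open>?I z * G z = 0\<close> using \<open>0 \<le> E\<close> by simp
  next
    case True
    note z = ellipsoid_pos_imp [OF conjunct2 [OF True] \<open>0 < \<tau>\<close> \<open>0 < R\<close>]
    have "\<bar>(snd z - a) \<bullet> i\<bar> \<le> R" if "i \<in> Basis" for i
      using Basis_le_norm [OF that, of "snd z - a"] z by linarith
    then have "snd z \<in> cbox (a - R *\<^sub>R One) (a + R *\<^sub>R One)"
      by (force simp: mem_box inner_simps abs_le_iff)
    moreover have "fst z \<in> cbox 0 \<tau>"
      using True z by (auto simp: mem_Times_iff)
    ultimately have "z \<in> Q"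
      by (simp add: Q_def cbox_Pair_eq mem_Times_iff)
    have "R \<le> norm (snd z)"
      using norm_triangle_ineq2 [of a "a - snd z"] a z by (simp add: norm_minus_commute)
    then have "R powr \<sigma> \<le> norm (snd z) powr \<sigma>"
      using assms by (intro powr_mono2) auto
    then have "- E \<le> G z"
      unfolding E_def G_def
      by (intro integrand_lower_bound) (use assms K\<^sub>1 [of z] K\<^sub>2 [of z] True nonneg in \<open>auto simp: \<phi>_def flat_nonneg\<close>)
    then show ?thesis
      using True \<open>z \<in> Q\<close> by simp
  qed
  have "(LINT x|lebesgue. u0 x * \<phi> (0, x)) = (LINT z|lebesgue. - (?I z * G z))"
    using identity by (simp add: set_lebesgue_integral_def)
  \<comment> \<open>If the integrand is not integrable, its integral is zero by convention and the inequality
    still holds.\<close>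
  also have "\<dots> \<le> (LINT z|lebesgue. E * indicator Q z)"
  proof (rule integral_mono_AE')
    show "integrable lebesgue (\<lambda>z. E * indicator Q z)"
      by (simp add: Q_def flip: lmeasurable_iff_integrable)
    show "AE z in lebesgue. - (?I z * G z) \<le> E * indicator Q z"
      using u unfolding weak_solution_def by (auto elim!: eventually_mono intro: bound)
    show "AE z in lebesgue. 0 \<le> E * indicator Q z"
      using \<open>0 \<le> E\<close> by simp
  qed
  also have "\<dots> = E * measure lborel Q"
    by (simp add: Q_def)
  also have "measure lborel Q = \<tau> * (2 * R) ^ DIM('a)"
    unfolding Q_def by (rule content_spacetime_box) (use assms in auto)
  finally show ?thesis
    by (simp add: E_def \<phi>_def mult.commute)
qed

text \<open>For the lower bound it suffices to integrate over the ball of half the radius, where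
  \<open>ellipsoid \<tau> R a (0, x) \<ge> 3 / 4\<close>.\<close>

lemma initial_datum_integral_ge:
  fixes u0 :: "'a::euclidean_space \<Rightarrow> real"
  assumes u0: "initial_datum \<gamma> L u0" and "0 < L" and "0 < \<gamma>"
  shows "\<exists>R\<^sub>0>0. \<forall>R\<ge>R\<^sub>0. \<forall>\<tau> a. norm a = 2 * R \<longrightarrow>
    L / 2 * (3 * R) powr - \<gamma> * flat 0 (3 / 4) * ((R / 2) ^ DIM('a) * measure lborel (ball (0 :: 'a) 1))
    \<le> (LINT x|lebesgue. u0 x * flat 0 (ellipsoid \<tau> R a (0, x)))"
proof -
  obtain C where meas: "u0 \<in> borel_measurable lebesgue" and C: "AE x in lebesgue. \<bar>u0 x\<bar> \<le> C"
    and nonneg: "AE x in lebesgue. 0 \<le> u0 x" and lim: "((\<lambda>x. norm x powr \<gamma> * u0 x) \<longlongrightarrow> L) at_infinity"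
    using u0 unfolding initial_datum_def by blast
  have "\<forall>\<^sub>F x in at_infinity. L / 2 < norm x powr \<gamma> * u0 x"
    by (rule order_tendstoD [OF lim]) (use \<open>0 < L\<close> in simp)
  then obtain b where b: "\<And>x. b \<le> norm x \<Longrightarrow> L / 2 < norm x powr \<gamma> * u0 x"
    unfolding eventually_at_infinity by blast
  have "L / 2 * (3 * R) powr - \<gamma> * flat 0 (3 / 4) * ((R / 2) ^ DIM('a) * measure lborel (ball (0 :: 'a) 1))
      \<le> (LINT x|lebesgue. u0 x * flat 0 (ellipsoid \<tau> R a (0, x)))"
    if R: "max b 1 \<le> R" and a: "norm a = 2 * R" for R \<tau> and a :: 'a
  proof -
    define g where "g x = flat 0 (ellipsoid \<tau> R a (0, x))" for x
    define c where "c = L / 2 * (3 * R) powr - \<gamma> * flat 0 (3 / 4)"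
    have "0 < R"
      using R by simp
    have g: "0 \<le> g x" "g x \<le> indicator (cball a R) x" for x
    proof -
      show "0 \<le> g x"
        by (simp add: g_def flat_nonneg)
      show "g x \<le> indicator (cball a R) x"
      proof (cases "x \<in> cball a R")
        case True
        then show ?thesis
          using flat_le_fact [of 0] by (simp add: g_def)
      next
        case False
        then have "R\<^sup>2 \<le> (norm (x - a))\<^sup>2"
          using \<open>0 < R\<close> by (intro power_mono) (auto simp: dist_norm norm_minus_commute)
        then show ?thesis
          using False \<open>0 < R\<close> by (simp add: g_def ellipsoid_def flat_nonpos_eq_0)
      qed
    qed
    have "C_k 0 (\<lambda>z. flat 0 (ellipsoid \<tau> R a z))"
      by (intro C_k_flat_comp C_k_ellipsoid)
    then have "continuous_on UNIV (\<lambda>z. flat 0 (ellipsoid \<tau> R a z))"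
      by simp
    then have "continuous_on UNIV (\<lambda>x. flat 0 (ellipsoid \<tau> R a (0, x)))"
      by (rule continuous_on_compose2 [where f = "\<lambda>x. (0, x)"]) (auto intro!: continuous_intros)
    then have "continuous_on UNIV g"
      by (simp only: g_def [abs_def])
    then have g_meas: "g \<in> borel_measurable lebesgue"
      by (intro measurable_completion) (simp add: borel_measurable_continuous_onI)
    have "integrable lebesgue (\<lambda>x. C * indicator (cball a R) x)"
      by (simp flip: lmeasurable_iff_integrable)
    then have int: "integrable lebesgue (\<lambda>x. u0 x * g x)"
    proof (rule Bochner_Integration.integrable_bound)
      show "(\<lambda>x. u0 x * g x) \<in> borel_measurable lebesgue"
        using meas g_meas by measurable
      show "AE x in lebesgue. norm (u0 x * g x) \<le> norm (C * indicator (cball a R) x)"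
        using C
      proof eventually_elim
        case (elim x)
        then have "\<bar>u0 x\<bar> * g x \<le> C * indicator (cball a R) x"
          using g [of x] by (intro mult_mono) auto
        also have "\<dots> \<le> \<bar>C * indicator (cball a R) x\<bar>"
          by simp
        finally show ?case
          using g [of x] by (simp add: abs_mult)
      qed
    qed
    have "c * ((R / 2) ^ DIM('a) * measure lborel (ball (0 :: 'a) 1)) = (LINT x|lebesgue. c * indicator (ball a (R / 2)) x)"
      using \<open>0 < R\<close> content_ball_conv_unit_ball [of "R / 2" a] by simp
    also have "\<dots> \<le> (LINT x|lebesgue. u0 x * g x)"
    proof (rule integral_mono_AE)
      show "integrable lebesgue (\<lambda>x. c * indicator (ball a (R / 2)) x)"
        by (simp flip: lmeasurable_iff_integrable)
      show "AE x in lebesgue. c * indicator (ball a (R / 2)) x \<le> u0 x * g x"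
        using nonneg
      proof eventually_elim
        case (elim x)
        show ?case
        proof (cases "x \<in> ball a (R / 2)")
          case True
          then have near: "norm (x - a) \<le> R / 2"
            by (simp add: dist_norm norm_minus_commute)
          have "R \<le> norm x"
            using norm_triangle_ineq2 [of a "a - x"] a near \<open>0 < R\<close> by (simp add: norm_minus_commute)
          moreover have "norm x \<le> 3 * R"
            using norm_triangle_ineq [of a "x - a"] a near \<open>0 < R\<close> by simp
          ultimately have x: "0 < norm x" "b \<le> norm x" "norm x \<le> 3 * R"
            using R by auto
          have "L / 2 * (3 * R) powr - \<gamma> \<le> L / 2 * norm x powr - \<gamma>"
            using x assms by (intro mult_left_mono powr_mono2') auto
          also have "\<dots> \<le> u0 x"
            using b [OF x(2)] x(1) by (simp add: powr_minus field_simps)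
          finally have u0_ge: "L / 2 * (3 * R) powr - \<gamma> \<le> u0 x" .
          have "(norm (x - a))\<^sup>2 \<le> (R / 2)\<^sup>2"
            by (rule power_mono [OF near]) simp
          then have "3 / 4 \<le> ellipsoid \<tau> R a (0, x)"
            using \<open>0 < R\<close> by (simp add: ellipsoid_def power_divide field_simps)
          then have "flat 0 (3 / 4) \<le> g x"
            unfolding g_def by (rule flat_0_mono)
          then have "c \<le> u0 x * g x"
            unfolding c_def using u0_ge elim by (intro mult_mono) (auto simp: flat_nonneg)
          then show ?thesis
            using True by simp
        qed (use elim g in simp)
      qed
    qed (rule int)
    finally show ?thesis
      by (simp add: c_def g_def)
  qed
  then show ?thesis
    by (intro exI [of _ "max b 1"]) auto
qed

text \<open>The outcome of the test function method on the ball of radius \<open>R\<close> around a point at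
  distance \<open>2 * R\<close> from the origin, over a time interval of length \<open>\<tau>\<close>. The constant depends
  neither on the solution nor on its existence time \<open>T\<close>.\<close>

lemma weak_solution_tail_estimate:
  fixes m p \<sigma> :: real
  assumes "0 < m" "m < p" "1 < p" "0 < \<sigma>"
  obtains C where "0 < C" and "\<And>(u0 :: 'a::euclidean_space \<Rightarrow> real) \<gamma> L T u.
    0 < \<gamma> \<Longrightarrow> 0 < L \<Longrightarrow> initial_datum \<gamma> L u0 \<Longrightarrow> weak_solution m p \<sigma> u0 T u \<Longrightarrow>
    \<exists>R\<^sub>0>0. \<forall>R\<ge>R\<^sub>0. \<forall>\<tau>. 0 < \<tau> \<and> \<tau> < T \<longrightarrow>
      L * (3 * R) powr - \<gamma> \<le> C * ((\<tau> * R powr \<sigma>) powr (- 1 / (p - 1))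
        + \<tau> * R powr - ((2 * p + \<sigma> * m) / (p - m)))"
proof -
  obtain K\<^sub>1 where "0 < K\<^sub>1" and K\<^sub>1: "\<And>\<tau> R (a :: 'a) z. 0 < \<tau> \<Longrightarrow> 0 < R \<Longrightarrow>
      \<bar>dt (\<lambda>z. flat 0 (ellipsoid \<tau> R a z)) z\<bar> \<le> K\<^sub>1 / \<tau> * flat 0 (ellipsoid \<tau> R a z) powr (1 / p)"
    using bump_derivative_bounds [of "1 / p", where 'a = 'a] assms by auto
  obtain K\<^sub>2 where "0 < K\<^sub>2" and K\<^sub>2: "\<And>\<tau> R (a :: 'a) z. 0 < \<tau> \<Longrightarrow> 0 < R \<Longrightarrow>
      \<bar>laplacian (\<lambda>z. flat 0 (ellipsoid \<tau> R a z)) z\<bar> \<le> K\<^sub>2 / R\<^sup>2 * flat 0 (ellipsoid \<tau> R a z) powr (m / p)"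
    using bump_derivative_bounds [of "m / p", where 'a = 'a] assms by auto
  define \<beta> where "\<beta> = flat 0 (3 / 4) * measure lborel (ball (0 :: 'a) 1)"
  define M\<^sub>1 where "M\<^sub>1 = K\<^sub>1 * (2 * K\<^sub>1) powr (1 / (p - 1))"
  define M\<^sub>2 where "M\<^sub>2 = K\<^sub>2 * (2 * K\<^sub>2) powr (m / (p - m))"
  define C where "C = 2 * 4 ^ DIM('a) / \<beta> * (M\<^sub>1 + M\<^sub>2)"
  have "0 < \<beta>"
    using content_ball_pos [of 1 "0 :: 'a"] by (simp add: \<beta>_def flat_def)
  have M: "0 < M\<^sub>1" "0 < M\<^sub>2"
    using \<open>0 < K\<^sub>1\<close> \<open>0 < K\<^sub>2\<close> by (simp_all add: M\<^sub>1_def M\<^sub>2_def)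
  have "0 < C"
    using \<open>0 < \<beta>\<close> M by (simp add: C_def)
  obtain e :: 'a where e: "norm e = 1"
    using norm_Basis nonempty_Basis by blast
  have "\<exists>R\<^sub>0>0. \<forall>R\<ge>R\<^sub>0. \<forall>\<tau>. 0 < \<tau> \<and> \<tau> < T \<longrightarrow>
      L * (3 * R) powr - \<gamma> \<le> C * ((\<tau> * R powr \<sigma>) powr (- 1 / (p - 1))
        + \<tau> * R powr - ((2 * p + \<sigma> * m) / (p - m)))"
    if "0 < \<gamma>" "0 < L" and u0: "initial_datum \<gamma> L u0" and u: "weak_solution m p \<sigma> u0 T u"
    for u0 :: "'a \<Rightarrow> real" and \<gamma> L T u
  proof -
    obtain R\<^sub>0 where "0 < R\<^sub>0" and R\<^sub>0: "\<And>R \<tau> a. R\<^sub>0 \<le> R \<Longrightarrow> norm a = 2 * R \<Longrightarrow>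
        L / 2 * (3 * R) powr - \<gamma> * flat 0 (3 / 4) * ((R / 2) ^ DIM('a) * measure lborel (ball (0 :: 'a) 1))
        \<le> (LINT x|lebesgue. u0 x * flat 0 (ellipsoid \<tau> R a (0, x)))"
      using initial_datum_integral_ge [OF u0 \<open>0 < L\<close> \<open>0 < \<gamma>\<close>] by blast
    have "L * (3 * R) powr - \<gamma> \<le> C * ((\<tau> * R powr \<sigma>) powr (- 1 / (p - 1))
        + \<tau> * R powr - ((2 * p + \<sigma> * m) / (p - m)))"
      if R: "R\<^sub>0 \<le> R" and \<tau>: "0 < \<tau>" "\<tau> < T" for R \<tau>
    proof -
      define X where "X = (\<tau> * R powr \<sigma>) powr (- 1 / (p - 1))"
      define Y where "Y = \<tau> * R powr - ((2 * p + \<sigma> * m) / (p - m))"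
      define E where "E = K\<^sub>1 / \<tau> * (2 * (K\<^sub>1 / \<tau>) / R powr \<sigma>) powr (1 / (p - 1))
        + K\<^sub>2 / R\<^sup>2 * (2 * (K\<^sub>2 / R\<^sup>2) / R powr \<sigma>) powr (m / (p - m))"
      have "0 < R"
        using R \<open>0 < R\<^sub>0\<close> by simp
      have "0 \<le> X" "0 \<le> Y"
        using \<tau> by (simp_all add: X_def Y_def)
      define a where "a = (2 * R) *\<^sub>R e"
      have a: "norm a = 2 * R"
        using e \<open>0 < R\<close> by (simp add: a_def)
      have "0 < K\<^sub>1 / \<tau>" "0 < K\<^sub>2 / R\<^sup>2"
        using \<tau> \<open>0 < R\<close> \<open>0 < K\<^sub>1\<close> \<open>0 < K\<^sub>2\<close> by simp_all
      note upper = weak_solution_initial_integral_le [OF u assms \<tau> \<open>0 < R\<close> a this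
        K\<^sub>1 [OF \<tau>(1) \<open>0 < R\<close>] K\<^sub>2 [OF \<tau>(1) \<open>0 < R\<close>]]
      have "L / 2 * (3 * R) powr - \<gamma> * flat 0 (3 / 4) * ((R / 2) ^ DIM('a) * measure lborel (ball (0 :: 'a) 1))
          \<le> \<tau> * (2 * R) ^ DIM('a) * E"
        unfolding E_def by (rule order_trans [OF R\<^sub>0 [OF R a] upper])
      then have "L * (3 * R) powr - \<gamma> * (\<beta> * (R / 2) ^ DIM('a)) \<le> 2 * \<tau> * (2 * R) ^ DIM('a) * E"
        by (simp add: \<beta>_def mult_ac)
      also have "\<dots> = 2 * 4 ^ DIM('a) / \<beta> * (\<tau> * E) * (\<beta> * (R / 2) ^ DIM('a))"
      proof -
        have "(2 * R) ^ DIM('a) = (4 * (R / 2)) ^ DIM('a)"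
          by simp
        also have "\<dots> = 4 ^ DIM('a) * (R / 2) ^ DIM('a)"
          by (rule power_mult_distrib)
        finally have "(2 * R) ^ DIM('a) = 4 ^ DIM('a) * (R / 2) ^ DIM('a)" .
        then show ?thesis
          using \<open>0 < \<beta>\<close> by (simp only:) (simp add: mult_ac)
      qed
      finally have le: "L * (3 * R) powr - \<gamma> \<le> 2 * 4 ^ DIM('a) / \<beta> * (\<tau> * E)"
        using \<open>0 < \<beta>\<close> \<open>0 < R\<close> by (subst (asm) mult_le_cancel_right_pos) auto
      have inverse_powr_eq: "inverse y powr (1 / (p - 1)) = y powr (- 1 / (p - 1))" for y :: real
        by (simp add: powr_minus inverse_powr)
      have "2 * (K\<^sub>1 / \<tau>) / R powr \<sigma> = (2 * K\<^sub>1) * inverse (\<tau> * R powr \<sigma>)"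
        by (simp add: field_simps)
      then have "(2 * (K\<^sub>1 / \<tau>) / R powr \<sigma>) powr (1 / (p - 1))
          = (2 * K\<^sub>1) powr (1 / (p - 1)) * inverse (\<tau> * R powr \<sigma>) powr (1 / (p - 1))"
        using \<open>0 < K\<^sub>1\<close> \<tau> by (simp add: powr_mult)
      also have "inverse (\<tau> * R powr \<sigma>) powr (1 / (p - 1)) = X"
        unfolding X_def by (rule inverse_powr_eq)
      finally have 1: "\<tau> * (K\<^sub>1 / \<tau> * (2 * (K\<^sub>1 / \<tau>) / R powr \<sigma>) powr (1 / (p - 1))) = M\<^sub>1 * X"
        using \<tau> by (simp add: M\<^sub>1_def)
      have "2 * (K\<^sub>2 / R\<^sup>2) / R powr \<sigma> = (2 * K\<^sub>2) * R powr (- (2 + \<sigma>))"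
        using powr_minus [of R "2 + \<sigma>"] powr_add [of R 2 \<sigma>] \<open>0 < R\<close> by (simp add: field_simps)
      then have "(2 * (K\<^sub>2 / R\<^sup>2) / R powr \<sigma>) powr (m / (p - m))
          = (2 * K\<^sub>2) powr (m / (p - m)) * R powr (- (2 + \<sigma>) * (m / (p - m)))"
        using \<open>0 < K\<^sub>2\<close> by (simp add: powr_mult powr_powr)
      then have "\<tau> * (K\<^sub>2 / R\<^sup>2 * (2 * (K\<^sub>2 / R\<^sup>2) / R powr \<sigma>) powr (m / (p - m)))
          = M\<^sub>2 * (\<tau> * (R powr - 2 * R powr (- (2 + \<sigma>) * (m / (p - m)))))"
        using \<open>0 < R\<close> by (simp add: M\<^sub>2_def powr_minus field_simps)
      also have "R powr - 2 * R powr (- (2 + \<sigma>) * (m / (p - m))) = R powr (- 2 + - (2 + \<sigma>) * (m / (p - m)))"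
        by (rule powr_add [symmetric])
      also have "- 2 + - (2 + \<sigma>) * (m / (p - m)) = - ((2 * p + \<sigma> * m) / (p - m))"
        using assms by (simp add: field_simps)
      finally have 2: "\<tau> * (K\<^sub>2 / R\<^sup>2 * (2 * (K\<^sub>2 / R\<^sup>2) / R powr \<sigma>) powr (m / (p - m))) = M\<^sub>2 * Y"
        by (simp add: Y_def)
      have "\<tau> * E = M\<^sub>1 * X + M\<^sub>2 * Y"
        unfolding E_def distrib_left 1 2 ..
      also have "\<dots> \<le> (M\<^sub>1 + M\<^sub>2) * (X + Y)"
        using M \<open>0 \<le> X\<close> \<open>0 \<le> Y\<close> by (simp add: algebra_simps)
      finally have "2 * 4 ^ DIM('a) / \<beta> * (\<tau> * E) \<le> 2 * 4 ^ DIM('a) / \<beta> * ((M\<^sub>1 + M\<^sub>2) * (X + Y))"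
        using \<open>0 < \<beta>\<close> by (intro mult_left_mono) auto
      with le show ?thesis
        unfolding C_def X_def [symmetric] Y_def [symmetric] by (simp only: mult.assoc)
    qed
    then show ?thesis
      using \<open>0 < R\<^sub>0\<close> by blast
  qed
  with \<open>0 < C\<close> show ?thesis
    by (rule that)
qed

text \<open>The tail estimate for the time scale \<open>\<tau> = c * R powr - \<delta>\<close>, multiplied by \<open>R powr \<gamma>\<close>.\<close>

lemma weak_solution_scaled_estimate:
  fixes m p \<sigma> :: real
  assumes "0 < m" "m < p" "1 < p" "0 < \<sigma>"
  obtains C where "0 < C" and "\<And>(u0 :: 'a::euclidean_space \<Rightarrow> real) \<gamma> L T u c \<delta>.
    0 < \<gamma> \<Longrightarrow> 0 < L \<Longrightarrow> initial_datum \<gamma> L u0 \<Longrightarrow> weak_solution m p \<sigma> u0 T u \<Longrightarrow>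
    0 < c \<Longrightarrow> \<forall>\<^sub>F R in at_top. c * R powr - \<delta> < T \<Longrightarrow>
    \<forall>\<^sub>F R in at_top. L * 3 powr - \<gamma> \<le> C * (c powr (- 1 / (p - 1)) * R powr (\<gamma> - (\<sigma> - \<delta>) / (p - 1))
      + c * R powr (\<gamma> - (\<delta> + (2 * p + \<sigma> * m) / (p - m))))"
proof -
  obtain C where "0 < C" and C: "\<And>(u0 :: 'a \<Rightarrow> real) \<gamma> L T u.
    0 < \<gamma> \<Longrightarrow> 0 < L \<Longrightarrow> initial_datum \<gamma> L u0 \<Longrightarrow> weak_solution m p \<sigma> u0 T u \<Longrightarrow>
    \<exists>R\<^sub>0>0. \<forall>R\<ge>R\<^sub>0. \<forall>\<tau>. 0 < \<tau> \<and> \<tau> < T \<longrightarrow>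
      L * (3 * R) powr - \<gamma> \<le> C * ((\<tau> * R powr \<sigma>) powr (- 1 / (p - 1))
        + \<tau> * R powr - ((2 * p + \<sigma> * m) / (p - m)))"
    by (rule weak_solution_tail_estimate [OF assms, where 'a = 'a], rule that)
  have "\<forall>\<^sub>F R in at_top. L * 3 powr - \<gamma> \<le> C * (c powr (- 1 / (p - 1)) * R powr (\<gamma> - (\<sigma> - \<delta>) / (p - 1))
        + c * R powr (\<gamma> - (\<delta> + (2 * p + \<sigma> * m) / (p - m))))"
    if hyps: "0 < \<gamma>" "0 < L" "initial_datum \<gamma> L u0" "weak_solution m p \<sigma> u0 T u"
      and "0 < c" and T: "\<forall>\<^sub>F R in at_top. c * R powr - \<delta> < T"
    for u0 :: "'a \<Rightarrow> real" and \<gamma> L T u c \<delta>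
  proof -
    obtain R\<^sub>0 where R\<^sub>0: "0 < R\<^sub>0" "\<And>R \<tau>. R\<^sub>0 \<le> R \<Longrightarrow> 0 < \<tau> \<Longrightarrow> \<tau> < T \<Longrightarrow>
        L * (3 * R) powr - \<gamma> \<le> C * ((\<tau> * R powr \<sigma>) powr (- 1 / (p - 1))
          + \<tau> * R powr - ((2 * p + \<sigma> * m) / (p - m)))"
      using C [OF hyps] by blast
    show ?thesis
      using T eventually_ge_at_top [of R\<^sub>0]
    proof eventually_elim
      case (elim R)
      have "0 < R"
        using elim R\<^sub>0(1) by simp
      have \<tau>_eq: "c * R powr - \<delta> * R powr \<sigma> = c * R powr (\<sigma> - \<delta>)"
        using powr_add [of R "- \<delta>" \<sigma>] by simp
      have 1: "(c * R powr - \<delta> * R powr \<sigma>) powr (- 1 / (p - 1))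
          = c powr (- 1 / (p - 1)) * R powr (- ((\<sigma> - \<delta>) / (p - 1)))"
        unfolding \<tau>_eq using \<open>0 < c\<close> by (subst powr_mult) (simp_all add: powr_powr)
      have 2: "c * R powr - \<delta> * R powr - ((2 * p + \<sigma> * m) / (p - m))
          = c * R powr (- (\<delta> + (2 * p + \<sigma> * m) / (p - m)))"
        using powr_add [of R "- \<delta>" "- ((2 * p + \<sigma> * m) / (p - m))"] by simp
      have "L * (3 * R) powr - \<gamma> \<le> C * (c powr (- 1 / (p - 1)) * R powr (- ((\<sigma> - \<delta>) / (p - 1)))
          + c * R powr (- (\<delta> + (2 * p + \<sigma> * m) / (p - m))))"
        using R\<^sub>0(2) [of R "c * R powr - \<delta>"] elim \<open>0 < c\<close> \<open>0 < R\<close> unfolding 1 2 by simp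
      then have "R powr \<gamma> * (L * (3 * R) powr - \<gamma>)
          \<le> R powr \<gamma> * (C * (c powr (- 1 / (p - 1)) * R powr (- ((\<sigma> - \<delta>) / (p - 1)))
            + c * R powr (- (\<delta> + (2 * p + \<sigma> * m) / (p - m)))))"
        by (rule mult_left_mono) simp
      also have "R powr \<gamma> * (L * (3 * R) powr - \<gamma>) = L * 3 powr - \<gamma> * (R powr \<gamma> * R powr - \<gamma>)"
        using \<open>0 < R\<close> by (simp add: powr_mult)
      also have "R powr \<gamma> * R powr - \<gamma> = 1"
        using \<open>0 < R\<close> by (simp add: powr_minus)
      also have "R powr \<gamma> * (C * (c powr (- 1 / (p - 1)) * R powr (- ((\<sigma> - \<delta>) / (p - 1)))
            + c * R powr (- (\<delta> + (2 * p + \<sigma> * m) / (p - m)))))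
          = C * (c powr (- 1 / (p - 1)) * (R powr \<gamma> * R powr (- ((\<sigma> - \<delta>) / (p - 1))))
            + c * (R powr \<gamma> * R powr (- (\<delta> + (2 * p + \<sigma> * m) / (p - m)))))"
        by (simp only: distrib_left mult_ac)
      finally show ?case
        by (simp only: powr_add [symmetric] add_uminus_conv_diff mult_1_right)
    qed
  qed
  with \<open>0 < C\<close> show ?thesis
    by (rule that)
qed

section \<open>Instantaneous blow-up\<close>

lemma decaying_powr_bound_nonpos:
  fixes A B B' s t :: real
  assumes "s < 0" and "t < 0" and "\<forall>\<^sub>F R in at_top. A \<le> C * (B * R powr s + B' * R powr t)"
  shows "A \<le> 0"
proof (rule tendsto_lowerbound [OF _ assms(3)])
  have "((\<lambda>R. C * (B * R powr s + B' * R powr t)) \<longlongrightarrow> C * (B * 0 + B' * 0)) at_top"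
    using assms by (intro tendsto_intros tendsto_neg_powr filterlim_ident)
  then show "((\<lambda>R. C * (B * R powr s + B' * R powr t)) \<longlongrightarrow> 0) at_top"
    by simp
qed simp

theorem theorem1p1:
  fixes m p \<sigma> :: real
  assumes "0 < m" and "max 1 m < p" and "0 < \<sigma>"
  shows "\<sigma> / (p - 1) = (\<sigma> + 2) / (p - m) - 2 * (p - p_G m \<sigma>) / ((p - 1) * (p - m)) \<and>
    (\<forall>(u0 :: real ^ 'n \<Rightarrow> real) \<gamma> L.
       0 < \<gamma> \<and> 0 < L \<and> initial_datum \<gamma> L u0 \<and>
       (p_G m \<sigma> \<le> p \<and> \<gamma> < \<sigma> / (p - 1) \<or>
        1 < p \<and> p < p_G m \<sigma> \<and> \<gamma> < (\<sigma> + 2) / (p - m)) \<longrightarrow>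
       no_solution m p \<sigma> u0) \<and>
    (\<exists>L0>0. \<forall>(u0 :: real ^ 'n \<Rightarrow> real) \<gamma> L.
       0 < \<gamma> \<and> 0 < L \<and> initial_datum \<gamma> L u0 \<and>
       1 < p \<and> p < p_G m \<sigma> \<and> \<gamma> = (\<sigma> + 2) / (p - m) \<and> L0 < L \<longrightarrow>
       no_solution m p \<sigma> u0)"
proof -
  have p: "1 < p" "m < p"
    using assms by auto
  have identity: "\<sigma> / (p - 1) = (\<sigma> + 2) / (p - m) - 2 * (p - p_G m \<sigma>) / ((p - 1) * (p - m))"
    using p by (simp add: p_G_def divide_simps) (simp add: algebra_simps)
  define \<kappa> where "\<kappa> = (2 * p + \<sigma> * m) / (p - m)"
  obtain C where "0 < C" and C: "\<And>(u0 :: real ^ 'n \<Rightarrow> real) \<gamma> L T u c \<delta>.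
    0 < \<gamma> \<Longrightarrow> 0 < L \<Longrightarrow> initial_datum \<gamma> L u0 \<Longrightarrow> weak_solution m p \<sigma> u0 T u \<Longrightarrow>
    0 < c \<Longrightarrow> \<forall>\<^sub>F R in at_top. c * R powr - \<delta> < T \<Longrightarrow>
    \<forall>\<^sub>F R in at_top. L * 3 powr - \<gamma> \<le> C * (c powr (- 1 / (p - 1)) * R powr (\<gamma> - (\<sigma> - \<delta>) / (p - 1))
      + c * R powr (\<gamma> - (\<delta> + \<kappa>)))"
    by (rule weak_solution_scaled_estimate [OF assms(1) p(2,1) assms(3), where 'a = "real ^ 'n",
      folded \<kappa>_def], rule that)
  have supercritical: False
    if "p_G m \<sigma> \<le> p" "\<gamma> < \<sigma> / (p - 1)" "0 < \<gamma>" "0 < L" "initial_datum \<gamma> L u0" "0 < T"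
      "weak_solution m p \<sigma> u0 T u"
    for u0 :: "real ^ 'n \<Rightarrow> real" and \<gamma> L T u
  proof -
    \<comment> \<open>Here the time scale is kept fixed.\<close>
    have "\<sigma> * (p - m) \<le> (2 * p + \<sigma> * m) * (p - 1)"
    proof -
      have "0 \<le> 2 * p * (p - p_G m \<sigma>)"
        using that p by simp
      also have "\<dots> = (2 * p + \<sigma> * m) * (p - 1) - \<sigma> * (p - m)"
        by (simp add: p_G_def field_simps)
      finally show ?thesis
        by simp
    qed
    then have "\<sigma> / (p - 1) \<le> \<kappa>"
      using p by (simp add: \<kappa>_def divide_simps)
    with that have neg: "\<gamma> - (\<sigma> - 0) / (p - 1) < 0" "\<gamma> - (0 + \<kappa>) < 0"
      by simp_all
    have "\<forall>\<^sub>F R in at_top. T / 2 * R powr - 0 < T"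
      using eventually_gt_at_top [of 0] by eventually_elim (use that in simp)
    from decaying_powr_bound_nonpos [OF neg C [OF that(3-5) that(7) _ this]] have "L * 3 powr - \<gamma> \<le> 0"
      using that by simp
    then show False
      using that by (simp add: mult_le_0_iff)
  qed
  have subcritical: "\<forall>\<^sub>F R in at_top. L * 3 powr - \<gamma>
      \<le> C * (1 * R powr (\<gamma> - (\<sigma> + 2) / (p - m)) + 1 * R powr (\<gamma> - (\<sigma> + 2) / (p - m)))"
    if "p < p_G m \<sigma>" "0 < \<gamma>" "0 < L" "initial_datum \<gamma> L u0" "0 < T" "weak_solution m p \<sigma> u0 T u"
    for u0 :: "real ^ 'n \<Rightarrow> real" and \<gamma> L T u
  proof -
    \<comment> \<open>The time scale balances the two terms of the estimate and shrinks as the radius grows.\<close>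
    define \<delta> where "\<delta> = 2 * (p_G m \<sigma> - p) / (p - m)"
    have "0 < \<delta>"
      using that p by (simp add: \<delta>_def)
    have \<delta>1: "(\<sigma> - \<delta>) / (p - 1) = (\<sigma> + 2) / (p - m)"
      using p by (simp add: \<delta>_def p_G_def divide_simps) (simp add: algebra_simps)
    have \<delta>2: "\<delta> + \<kappa> = (\<sigma> + 2) / (p - m)"
      using p by (simp add: \<delta>_def \<kappa>_def p_G_def divide_simps) (simp add: algebra_simps)
    have "((\<lambda>R :: real. 1 * R powr - \<delta>) \<longlongrightarrow> 0) at_top"
      using \<open>0 < \<delta>\<close> by (auto intro!: tendsto_neg_powr filterlim_ident)
    then have "\<forall>\<^sub>F R in at_top. 1 * R powr - \<delta> < T"
      using \<open>0 < T\<close> by (rule order_tendstoD)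
    from C [OF that(2-4) that(6) _ this] show ?thesis
      by (simp add: \<delta>1 \<delta>2)
  qed
  have "no_solution m p \<sigma> u0"
    if "0 < \<gamma>" "0 < L" "initial_datum \<gamma> L u0" and
      "p_G m \<sigma> \<le> p \<and> \<gamma> < \<sigma> / (p - 1) \<or> 1 < p \<and> p < p_G m \<sigma> \<and> \<gamma> < (\<sigma> + 2) / (p - m)"
    for u0 :: "real ^ 'n \<Rightarrow> real" and \<gamma> L
    unfolding no_solution_def
  proof (intro allI impI notI)
    fix T :: real
    assume "0 < T" and "\<exists>u. weak_solution m p \<sigma> u0 T u"
    then obtain u where u: "weak_solution m p \<sigma> u0 T u"
      by blast
    from that(4) show False
    proof
      assume "p_G m \<sigma> \<le> p \<and> \<gamma> < \<sigma> / (p - 1)"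
      then show False
        using supercritical that(1-3) \<open>0 < T\<close> u by blast
    next
      assume sub: "1 < p \<and> p < p_G m \<sigma> \<and> \<gamma> < (\<sigma> + 2) / (p - m)"
      then have "\<gamma> - (\<sigma> + 2) / (p - m) < 0"
        by simp
      from decaying_powr_bound_nonpos [OF this this subcritical [OF _ that(1-3) \<open>0 < T\<close> u]]
      have "L * 3 powr - \<gamma> \<le> 0"
        using sub by simp
      then show False
        using that by (simp add: mult_le_0_iff)
    qed
  qed
  \<comment> \<open>For the critical \<open>\<gamma>\<close> all powers of \<open>R\<close> cancel, which leaves a bound on \<open>L\<close>.\<close>
  moreover have "no_solution m p \<sigma> u0"
    if "0 < \<gamma>" "0 < L" "initial_datum \<gamma> L u0" "p < p_G m \<sigma>" and \<gamma>: "\<gamma> = (\<sigma> + 2) / (p - m)"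
      and L: "2 * C * 3 powr ((\<sigma> + 2) / (p - m)) < L"
    for u0 :: "real ^ 'n \<Rightarrow> real" and \<gamma> L
    unfolding no_solution_def
  proof (intro allI impI notI)
    fix T :: real
    assume "0 < T" and "\<exists>u. weak_solution m p \<sigma> u0 T u"
    then obtain u where u: "weak_solution m p \<sigma> u0 T u"
      by blast
    have "\<forall>\<^sub>F R in at_top. (0 :: real) < R \<and> L * 3 powr - \<gamma> \<le> C * (1 * R powr 0 + 1 * R powr 0)"
      using subcritical [OF that(4,1-3) \<open>0 < T\<close> u] \<gamma> by (intro eventually_conj eventually_gt_at_top) simp
    then obtain R :: real where "0 < R" "L * 3 powr - \<gamma> \<le> C * (1 * R powr 0 + 1 * R powr 0)"
      using eventually_happens trivial_limit_at_top_linorder by blast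
    then have "L * 3 powr - \<gamma> \<le> 2 * C"
      by simp
    then have "L \<le> 2 * C * 3 powr \<gamma>"
      by (simp add: powr_minus field_simps)
    with L \<gamma> show False
      by simp
  qed
  moreover have "0 < 2 * C * 3 powr ((\<sigma> + 2) / (p - m))"
    using \<open>0 < C\<close> by simp
  ultimately show ?thesis
    using identity by blast
qed

end
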